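(* Consider the market with adjustable robust producers and elastic demand, with capacities $y^*$, productions $x^*(\cdot)$, prices $\pi^*(\cdot)$ and subsidies $\eta^*$ as defined in the context. Then $(\pi^*(\cdot),\eta^*,y^*,x^*(\cdot))$ is an equilibrium of the market with subsidized adjustable robust producers and consumers.
   Context: Let $\mathcal{N}=\{1,\dots,N\}$ (producers) and $\mathcal{T}=\{1,\dots,T\}$ (time periods). Data: investment costs $c^{\mathrm{inv}}_i\ge 0$, nominal variable costs $c^{\mathrm{var}}_i\ge 0$, scaling factors $a_i\ge 0$ ($i\in\mathcal{N}$), continuous strictly decreasing demand functions $p_t:\mathbb{R}\to\mathbb{R}$ ($t\in\mathcal{T}$). The uncertainty set $\mathcal{U}\subseteq[0,1]^{N\times T}$ is a convex polytope with $0\in\mathcal{U}$, whose projection onto every coordinate axis is $[0,1]$, and which is a Cartesian product $\mathcal{U}=\prod_{t\in\mathcal{T}}\mathcal{U}'$ for some $\mathcal{U}'\subseteq[0,1]^N$. The uncertain variable costs are $c^{\mathrm{var}}_{i,t}(u)=c^{\mathrm{var}}_i+a_iu_{i,t}$. Write $\bar x_t=\sum_{i\in\mathcal{N}}x_{i,t}$. Market: given price functions $\pi_t:\mathcal{U}\to\mathbb{R}$ ($t\in\mathcal{T}$) and per-unit capacity subsidies $\eta_i\in\mathbb{R}$ ($i\in\mathcal{N}$), producer $i$ solves $$\max_{y_i\ge 0}\ \min_{u\in\mathcal{U}}\ \max_{0\le x_{i,t}\le y_i\,(t\in\mathcal{T})}\ \sum_{t\in\mathcal{T}}(\pi_t(u)-c^{\mathrm{var}}_{i,t}(u))x_{i,t}-(c^{\mathrm{inv}}_i-\eta_i)y_i,$$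 and in each period $t$ and scenario $u$ the consumer solves $\max_{d_t\ge 0}\int_0^{d_t}p_t(s)\,ds-\pi_t(u)d_t$. Equilibrium: $(\pi(\cdot),\eta,y,x(\cdot))$ with $x:\mathcal{U}\to\mathbb{R}^{N\times T}_{\ge 0}$ is an equilibrium if (i) for every $i$, $y_i$ is optimal for the outer maximization of producer $i$, and for every $u\in\mathcal{U}$, $x_i(u)$ is optimal for the inner maximization of producer $i$ given $y_i$ and $u$; (ii) for every $u\in\mathcal{U}$ and $t\in\mathcal{T}$, the demand $d_t=\bar x_t(u)$ (market clearing) is optimal for the consumer. Capacities $y^*$: $(\hat x,y^* )$ is an optimal solution (assumed to exist) of the robust central planner problem $$\max_{x,y\ge 0}\ \min_{u\in\mathcal{U}}\ \sum_{t\in\mathcal{T}}\int_0^{\bar x_t}p_t(s)\,ds-\sum_{i\in\mathcal{N}}\Big(c^{\mathrm{inv}}_iy_i+\sum_{t\in\mathcal{T}}c^{\mathrm{var}}_{i,t}(u)x_{i,t}\Big)\quad\text{s.t. }x_{i,t}\le y_i\ \forall i,t.$$ Productions $x^*(u)$: for each $u\in\mathcal{U}$, $x^*(u)$ is an optimal solution of $$\max_{x,y\ge 0}\ \sum_{t\in\mathcal{T}}\int_0^{\bar x_t}p_t(s)\,ds-\sum_{i\in\mathcal{N}}\Big(c^{\mathrm{inv}}_iy_i+\sum_{t\in\mathcal{T}}c^{\mathrm{var}}_{i,t}(u)x_{i,t}\Big)\quad\text{s.t. } x_{i,t}\le y_i,\ y_i=y^*_i\ \forall i,t.$$ Prices: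 $\pi^*_t(u)=p_t(\bar x^*_t(u))$. Subsidies: the KKT system for $u\in\mathcal{U}$, in the unknowns $x,\mu,\phi\in\mathbb{R}^{N\times T}$ and $y,\chi,\eta\in\mathbb{R}^N$, is: for all $i\in\mathcal{N}$, $t\in\mathcal{T}$, $p_t(\bar x_t)-c^{\mathrm{var}}_{i,t}(u)-\mu_{i,t}+\phi_{i,t}=0$; $-c^{\mathrm{inv}}_i+\sum_{t}\mu_{i,t}+\chi_i+\eta_i=0$; $x_{i,t}\le y_i$; $y_i=y^*_i$; $\mu_{i,t}(x_{i,t}-y_i)=0$; $\phi_{i,t}x_{i,t}=0$; $\chi_iy_i=0$; $x,y,\mu,\phi,\chi\ge 0$ ($\eta$ free in sign). For each $i$, $\eta^*_i$ is the maximum of $\eta_i$ over all $(x,y,\mu,\phi,\chi,\eta)$ for which there exists $u\in\mathcal{U}$ such that $(x,y,\mu,\phi,\chi,\eta)$ solves the KKT system for $u$. *)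

theory Defs
  imports "HOL-Analysis.Analysis"
begin

text \<open>
  Producers and time periods are the elements of two arbitrary (nonempty) finite types \<open>'n\<close> and
  \<open>'t\<close>.  An \<open>N \<times> T\<close> array \<open>x\<close> has type \<open>real ^ 't ^ 'n\<close>, so that \<open>x $ i $ t\<close> is the entry of
  producer \<open>i\<close> in period \<open>t\<close>, \<open>x $ i\<close> is the profile of producer \<open>i\<close> over time, and \<open>column t x\<close>
  is the vector of all producers in period \<open>t\<close>.
\<close>

record ('n::finite, 't::finite) market =
  inv_cost :: "real ^ 'n"
  var_cost :: "real ^ 'n"
  scaling :: "real ^ 'n"
  demand :: "'t \<Rightarrow> real \<Rightarrow> real"
  uset :: "(real ^ 't ^ 'n) set"

definition uncertainty_set :: "(real ^ 't::finite ^ 'n::finite) set \<Rightarrow> bool" where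
  "uncertainty_set U \<longleftrightarrow>
     polytope U \<and> 0 \<in> U \<and>
     (\<forall>u\<in>U. \<forall>i t. u $ i $ t \<in> {0..1}) \<and>
     (\<forall>i t. (\<lambda>u. u $ i $ t) ` U = {0..1}) \<and>
     (\<exists>U'. (\<forall>v\<in>U'. \<forall>i. v $ i \<in> {0..1}) \<and> U = {u. \<forall>t. column t u \<in> U'})"

definition valid_market :: "('n::finite, 't::finite) market \<Rightarrow> bool" where
  "valid_market M \<longleftrightarrow>
     (\<forall>i. 0 \<le> inv_cost M $ i \<and> 0 \<le> var_cost M $ i \<and> 0 \<le> scaling M $ i) \<and>
     (\<forall>t. continuous_on UNIV (demand M t) \<and> strict_antimono_on UNIV (demand M t)) \<and>
     uncertainty_set (uset M)"

definition unc_cost ::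
    "('n::finite, 't::finite) market \<Rightarrow> real ^ 't ^ 'n \<Rightarrow> 'n \<Rightarrow> 't \<Rightarrow> real" where
  "unc_cost M u i t = var_cost M $ i + scaling M $ i * u $ i $ t"

definition aggregate :: "real ^ 't::finite ^ 'n::finite \<Rightarrow> 't \<Rightarrow> real" where
  "aggregate x t = (\<Sum>i\<in>UNIV. x $ i $ t)"


subsection \<open>The market and its equilibria\<close>

definition profit ::
    "('n::finite, 't::finite) market \<Rightarrow> ('t \<Rightarrow> real ^ 't ^ 'n \<Rightarrow> real) \<Rightarrow> real ^ 'n \<Rightarrow> 'n
      \<Rightarrow> real \<Rightarrow> real ^ 't ^ 'n \<Rightarrow> real ^ 't \<Rightarrow> real" where
  "profit M \<pi> \<eta> i yi u xi =
     (\<Sum>t\<in>UNIV. (\<pi> t u - unc_cost M u i t) * xi $ t) - (inv_cost M $ i - \<eta> $ i) * yi"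

definition production_set :: "real \<Rightarrow> (real ^ 't::finite) set" where
  "production_set yi = {xi. \<forall>t. 0 \<le> xi $ t \<and> xi $ t \<le> yi}"

text \<open>
  For \<open>0 \<le> yi\<close> the supremum is over a nonempty compact box, hence a maximum.
\<close>
definition best_profit ::
    "('n::finite, 't::finite) market \<Rightarrow> ('t \<Rightarrow> real ^ 't ^ 'n \<Rightarrow> real) \<Rightarrow> real ^ 'n \<Rightarrow> 'n
      \<Rightarrow> real \<Rightarrow> real ^ 't ^ 'n \<Rightarrow> real" where
  "best_profit M \<pi> \<eta> i yi u = (SUP xi\<in>production_set yi. profit M \<pi> \<eta> i yi u xi)"

definition worst_case_profit ::
    "('n::finite, 't::finite) market \<Rightarrow> ('t \<Rightarrow> real ^ 't ^ 'n \<Rightarrow> real) \<Rightarrow> real ^ 'n \<Rightarrow> 'n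
      \<Rightarrow> real \<Rightarrow> real" where
  "worst_case_profit M \<pi> \<eta> i yi = (INF u\<in>uset M. best_profit M \<pi> \<eta> i yi u)"

text \<open>
  The prices are arbitrary functions of the scenario, so an infimum over the scenarios need not be
  attained; the first conjunct requires that it is a minimum, as the max-min-max problem demands.
\<close>
definition investment_optimal ::
    "('n::finite, 't::finite) market \<Rightarrow> ('t \<Rightarrow> real ^ 't ^ 'n \<Rightarrow> real) \<Rightarrow> real ^ 'n \<Rightarrow> 'n
      \<Rightarrow> real \<Rightarrow> bool" where
  "investment_optimal M \<pi> \<eta> i yi \<longleftrightarrow>
     (\<forall>z\<ge>0. \<exists>u. is_arg_min (best_profit M \<pi> \<eta> i z) (\<lambda>u. u \<in> uset M) u) \<and>
     is_arg_max (worst_case_profit M \<pi> \<eta> i) (\<lambda>z. 0 \<le> z) yi"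

definition production_optimal ::
    "('n::finite, 't::finite) market \<Rightarrow> ('t \<Rightarrow> real ^ 't ^ 'n \<Rightarrow> real) \<Rightarrow> real ^ 'n \<Rightarrow> 'n
      \<Rightarrow> real \<Rightarrow> real ^ 't ^ 'n \<Rightarrow> real ^ 't \<Rightarrow> bool" where
  "production_optimal M \<pi> \<eta> i yi u xi \<longleftrightarrow>
     is_arg_max (profit M \<pi> \<eta> i yi u) (\<lambda>xi. xi \<in> production_set yi) xi"

definition consumer_optimal ::
    "('n::finite, 't::finite) market \<Rightarrow> ('t \<Rightarrow> real ^ 't ^ 'n \<Rightarrow> real)
      \<Rightarrow> real ^ 't ^ 'n \<Rightarrow> 't \<Rightarrow> real \<Rightarrow> bool" where
  "consumer_optimal M \<pi> u t d \<longleftrightarrow>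
     is_arg_max (\<lambda>d. integral {0..d} (demand M t) - \<pi> t u * d) (\<lambda>d. 0 \<le> d) d"

text \<open>
  Prices and productions are functions on \<open>uset M\<close>; their values elsewhere are irrelevant.
\<close>
definition is_equilibrium ::
    "('n::finite, 't::finite) market \<Rightarrow> ('t \<Rightarrow> real ^ 't ^ 'n \<Rightarrow> real) \<Rightarrow> real ^ 'n \<Rightarrow> real ^ 'n
      \<Rightarrow> (real ^ 't ^ 'n \<Rightarrow> real ^ 't ^ 'n) \<Rightarrow> bool" where
  "is_equilibrium M \<pi> \<eta> y x \<longleftrightarrow>
     (\<forall>u\<in>uset M. \<forall>i t. 0 \<le> x u $ i $ t) \<and>
     (\<forall>i. investment_optimal M \<pi> \<eta> i (y $ i) \<and>
          (\<forall>u\<in>uset M. production_optimal M \<pi> \<eta> i (y $ i) u (x u $ i))) \<and>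
     (\<forall>u\<in>uset M. \<forall>t. consumer_optimal M \<pi> u t (aggregate (x u) t))"


subsection \<open>The central planner and the induced capacities, productions, prices and subsidies\<close>

definition welfare ::
    "('n::finite, 't::finite) market \<Rightarrow> real ^ 't ^ 'n \<Rightarrow> (real ^ 't ^ 'n) \<times> (real ^ 'n) \<Rightarrow> real" where
  "welfare M u = (\<lambda>(x, y).
     (\<Sum>t\<in>UNIV. integral {0..aggregate x t} (demand M t))
     - (\<Sum>i\<in>UNIV. inv_cost M $ i * y $ i + (\<Sum>t\<in>UNIV. unc_cost M u i t * x $ i $ t)))"

definition feasible :: "(real ^ 't::finite ^ 'n::finite) \<times> (real ^ 'n) \<Rightarrow> bool" where
  "feasible = (\<lambda>(x, y). \<forall>i t. 0 \<le> x $ i $ t \<and> 0 \<le> y $ i \<and> x $ i $ t \<le> y $ i)"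

text \<open>
  Welfare is affine in \<open>u\<close> and the uncertainty set is a polytope, so the infimum is a minimum.
\<close>
definition robust_planner_optimal ::
    "('n::finite, 't::finite) market \<Rightarrow> real ^ 't ^ 'n \<Rightarrow> real ^ 'n \<Rightarrow> bool" where
  "robust_planner_optimal M x y \<longleftrightarrow>
     is_arg_max (\<lambda>z. INF u\<in>uset M. welfare M u z) feasible (x, y)"

definition fixed_capacity_optimal ::
    "('n::finite, 't::finite) market \<Rightarrow> real ^ 'n \<Rightarrow> real ^ 't ^ 'n \<Rightarrow> real ^ 't ^ 'n \<Rightarrow> bool" where
  "fixed_capacity_optimal M ystar u x \<longleftrightarrow>
     (\<exists>y. is_arg_max (welfare M u) (\<lambda>z. feasible z \<and> snd z = ystar) (x, y))"

definition market_price ::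
    "('n::finite, 't::finite) market \<Rightarrow> (real ^ 't ^ 'n \<Rightarrow> real ^ 't ^ 'n)
      \<Rightarrow> 't \<Rightarrow> real ^ 't ^ 'n \<Rightarrow> real" where
  "market_price M x t u = demand M t (aggregate (x u) t)"

text \<open>
  \<open>\<kappa>\<close> stands for the multiplier \<open>chi\<close> of \<open>y \<ge> 0\<close>, as the letter is taken by the vector binder.
\<close>
definition kkt_system ::
    "('n::finite, 't::finite) market \<Rightarrow> real ^ 'n \<Rightarrow> real ^ 't ^ 'n \<Rightarrow> real ^ 't ^ 'n \<Rightarrow> real ^ 'n
      \<Rightarrow> real ^ 't ^ 'n \<Rightarrow> real ^ 't ^ 'n \<Rightarrow> real ^ 'n \<Rightarrow> real ^ 'n \<Rightarrow> bool" where
  "kkt_system M ystar u x y \<mu> \<phi> \<kappa> \<eta> \<longleftrightarrow>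
     (\<forall>i t. demand M t (aggregate x t) - unc_cost M u i t - \<mu> $ i $ t + \<phi> $ i $ t = 0) \<and>
     (\<forall>i. - inv_cost M $ i + (\<Sum>t\<in>UNIV. \<mu> $ i $ t) + \<kappa> $ i + \<eta> $ i = 0) \<and>
     (\<forall>i t. x $ i $ t \<le> y $ i) \<and>
     (\<forall>i. y $ i = ystar $ i) \<and>
     (\<forall>i t. \<mu> $ i $ t * (x $ i $ t - y $ i) = 0) \<and>
     (\<forall>i t. \<phi> $ i $ t * x $ i $ t = 0) \<and>
     (\<forall>i. \<kappa> $ i * y $ i = 0) \<and>
     (\<forall>i t. 0 \<le> x $ i $ t \<and> 0 \<le> \<mu> $ i $ t \<and> 0 \<le> \<phi> $ i $ t) \<and>
     (\<forall>i. 0 \<le> y $ i \<and> 0 \<le> \<kappa> $ i)"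

definition kkt_subsidies ::
    "('n::finite, 't::finite) market \<Rightarrow> real ^ 'n \<Rightarrow> 'n \<Rightarrow> real set" where
  "kkt_subsidies M ystar i =
     {\<eta> $ i | x y \<mu> \<phi> \<kappa> \<eta>. \<exists>u\<in>uset M. kkt_system M ystar u x y \<mu> \<phi> \<kappa> \<eta>}"

definition is_max_subsidy ::
    "('n::finite, 't::finite) market \<Rightarrow> real ^ 'n \<Rightarrow> real ^ 'n \<Rightarrow> bool" where
  "is_max_subsidy M ystar \<eta>star \<longleftrightarrow>
     (\<forall>i. \<eta>star $ i \<in> kkt_subsidies M ystar i \<and>
          (\<forall>s\<in>kkt_subsidies M ystar i. s \<le> \<eta>star $ i))"

end

theory Submission
  imports Defs
begin

text \<open>
  For fixed capacities, the first-order conditions of the planner say that in each scenario and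
  period every producer either idles, runs at capacity or has margin zero at the price \<open>p\<^sub>t\<close>.
  Hence production is optimal for the producers, and since demand is strictly decreasing the
  aggregate production, and so the price, is the same for every KKT solution of the scenario.
  The largest subsidy compatible with the scenario \<open>u\<close> is therefore the investment cost minus the
  sum over time of the positive parts of the margins, and \<open>\<eta>\<^sup>*\<close> is the maximum of these numbers
  over \<open>u\<close>.  With this subsidy the worst-case profit of a producer is zero whatever its capacity,
  so every capacity, in particular \<open>y\<^sup>*\<close>, is an optimal investment.
\<close>

section \<open>Concavity of the consumer integral\<close>

text \<open>The integral is concave in its upper end with slope \<open>p a\<close> at
  \<open>a\<close>, and monotonicity bounds \<open>p\<close> between the two ends. Both ends must be
  nonnegative because \<open>{0..b}\<close> is empty for negative \<open>b\<close>.\<close>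

lemma integral_antimono_le_tangent:
  fixes p :: "real \<Rightarrow> real"
  assumes cont: "continuous_on UNIV p" and anti: "antimono p" and "0 \<le> a" "0 \<le> b"
  shows "integral {0..b} p - integral {0..a} p \<le> p a * (b - a)"
proof -
  have int: "p integrable_on {c..d}" for c d
    using cont by (meson continuous_on_subset integrable_continuous_real top_greatest)
  show ?thesis
  proof (cases "a \<le> b")
    case True
    have "integral {0..a} p + integral {a..b} p = integral {0..b} p"
      using True \<open>0 \<le> a\<close> by (intro Henstock_Kurzweil_Integration.integral_combine int)
    moreover have "integral {a..b} p \<le> integral {a..b} (\<lambda>_. p a)"
      using anti by (intro integral_le int) (auto simp: antimono_def)
    ultimately show ?thesis using True by (simp add: mult.commute)
  next
    case False
    have "integral {0..b} p + integral {b..a} p = integral {0..a} p"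
      using False \<open>0 \<le> b\<close> by (intro Henstock_Kurzweil_Integration.integral_combine int) auto
    moreover have "integral {b..a} (\<lambda>_. p a) \<le> integral {b..a} p"
      using anti by (intro integral_le int) (auto simp: antimono_def)
    ultimately show ?thesis using False by (simp add: algebra_simps)
  qed
qed

lemma valid_market_demand:
  assumes "valid_market M"
  shows "continuous_on UNIV (demand M t)" "antimono (demand M t)"
    "\<And>a b. a < b \<Longrightarrow> demand M t b < demand M t a"
proof -
  show "continuous_on UNIV (demand M t)"
    using assms by (simp add: valid_market_def)
  show less: "demand M t b < demand M t a" if "a < b" for a b
    using assms that by (auto simp: valid_market_def monotone_on_def)
  show "antimono (demand M t)"
    unfolding antimono_def using less by (metis order_le_less)
qed

section \<open>First-order conditions for fixed capacities\<close>

text \<open>With capacities fixed the constraints form a box, so single-entry changes are admissible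
  test moves.\<close>

definition update_entry ::
    "real ^ 't ^ 'n \<Rightarrow> 'n::finite \<Rightarrow> 't::finite \<Rightarrow> real \<Rightarrow> real ^ 't ^ 'n" where
  "update_entry x i t s = (\<chi> j r. if j = i \<and> r = t then s else x $ j $ r)"

lemma aggregate_update_entry:
  "aggregate (update_entry x i t s) r = aggregate x r + (if r = t then s - x $ i $ t else 0)"
proof -
  have "aggregate (update_entry x i t s) r - aggregate x r
      = (\<Sum>j\<in>UNIV. if j = i then (if r = t then s - x $ i $ t else 0) else 0)"
    unfolding aggregate_def update_entry_def sum_subtractf[symmetric]
    by (intro sum.cong) auto
  then show ?thesis by simp
qed

lemma welfare_update_entry:
  "welfare M u (update_entry x i t s, y) - welfare M u (x, y) =
     integral {0..aggregate x t + (s - x $ i $ t)} (demand M t) - integral {0..aggregate x t} (demand M t)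
     - unc_cost M u i t * (s - x $ i $ t)"
proof -
  let ?F = "\<lambda>r a. integral {0..a} (demand M r)"
  let ?x = "update_entry x i t s"
  have "(\<Sum>r\<in>UNIV. ?F r (aggregate ?x r)) - (\<Sum>r\<in>UNIV. ?F r (aggregate x r))
      = (\<Sum>r\<in>UNIV. if r = t then ?F t (aggregate x t + (s - x $ i $ t)) - ?F t (aggregate x t) else 0)"
    unfolding sum_subtractf[symmetric] by (intro sum.cong) (auto simp: aggregate_update_entry)
  also have "\<dots> = ?F t (aggregate x t + (s - x $ i $ t)) - ?F t (aggregate x t)"
    by simp
  finally have F: "(\<Sum>r\<in>UNIV. ?F r (aggregate ?x r)) - (\<Sum>r\<in>UNIV. ?F r (aggregate x r)) = \<dots>" .
  have row: "(\<Sum>r\<in>UNIV. unc_cost M u j r * ?x $ j $ r) - (\<Sum>r\<in>UNIV. unc_cost M u j r * x $ j $ r)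
      = (if j = i then unc_cost M u i t * (s - x $ i $ t) else 0)" for j
  proof -
    have "(\<Sum>r\<in>UNIV. unc_cost M u j r * ?x $ j $ r) - (\<Sum>r\<in>UNIV. unc_cost M u j r * x $ j $ r)
      = (\<Sum>r\<in>UNIV. if r = t then (if j = i then unc_cost M u i t * (s - x $ i $ t) else 0) else 0)"
      unfolding sum_subtractf[symmetric]
      by (intro sum.cong) (auto simp: update_entry_def algebra_simps)
    then show ?thesis by simp
  qed
  have "(\<Sum>j\<in>UNIV. inv_cost M $ j * y $ j + (\<Sum>r\<in>UNIV. unc_cost M u j r * ?x $ j $ r))
      - (\<Sum>j\<in>UNIV. inv_cost M $ j * y $ j + (\<Sum>r\<in>UNIV. unc_cost M u j r * x $ j $ r))
      = (\<Sum>j\<in>UNIV. if j = i then unc_cost M u i t * (s - x $ i $ t) else 0)"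
    unfolding row[symmetric] by (simp add: sum.distrib sum_subtractf)
  then have "(\<Sum>j\<in>UNIV. inv_cost M $ j * y $ j + (\<Sum>r\<in>UNIV. unc_cost M u j r * ?x $ j $ r))
      - (\<Sum>j\<in>UNIV. inv_cost M $ j * y $ j + (\<Sum>r\<in>UNIV. unc_cost M u j r * x $ j $ r))
      = unc_cost M u i t * (s - x $ i $ t)"
    by simp
  with F show ?thesis unfolding welfare_def prod.case by linarith
qed

lemma fixed_capacity_optimalD:
  assumes "fixed_capacity_optimal M ystar u x"
  shows "feasible (x, ystar)"
    and "\<And>x'. feasible (x', ystar) \<Longrightarrow> welfare M u (x', ystar) \<le> welfare M u (x, ystar)"
  using assms unfolding fixed_capacity_optimal_def is_arg_max_def by (auto simp: not_less)

lemma aggregate_nonneg: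
  assumes "feasible (x, y)"
  shows "0 \<le> aggregate x t"
  using assms by (auto simp: feasible_def aggregate_def intro: sum_nonneg)

text \<open>Moving a fraction \<open>h\<close> of the way towards \<open>s\<close> cannot raise
  welfare. Dividing by \<open>h\<close> and letting it tend to 0 gives the inequality, without
  differentiating the integral.\<close>

lemma fixed_capacity_first_order:
  assumes M: "valid_market M" and opt: "fixed_capacity_optimal M ystar u x"
    and s: "0 \<le> s" "s \<le> ystar $ i"
  shows "(demand M t (aggregate x t) - unc_cost M u i t) * (s - x $ i $ t) \<le> 0"
proof -
  define p where "p = demand M t"
  define a where "a = aggregate x t"
  define c where "c = unc_cost M u i t"
  define d where "d = s - x $ i $ t"
  note feas = fixed_capacity_optimalD(1)[OF opt]
  have x: "0 \<le> x $ i $ t" "x $ i $ t \<le> ystar $ i"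
    using feas by (auto simp: feasible_def)
  have step: "(p (a + h * d) - c) * d \<le> 0" if h: "0 < h" "h \<le> 1" for h
  proof -
    define r where "r = x $ i $ t + h * d"
    \<comment> \<open>As a convex combination, \<open>r\<close> stays within
      \<open>[0, ystar $ i]\<close>.\<close>
    have "r = (1 - h) * x $ i $ t + h * s"
      by (simp add: r_def d_def algebra_simps)
    then have r: "0 \<le> r" "r \<le> ystar $ i"
      using h s x by (auto intro: convex_bound_le)
    have feas': "feasible (update_entry x i t r, ystar)"
      using feas r by (auto simp: feasible_def update_entry_def)
    have "0 \<le> aggregate (update_entry x i t r) t"
      by (rule aggregate_nonneg[OF feas'])
    then have nonneg: "0 \<le> a + h * d"
      by (simp add: aggregate_update_entry a_def r_def)
    have "integral {0..a + h * d} p - integral {0..a} p - c * (h * d) \<le> 0"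
      using fixed_capacity_optimalD(2)[OF opt feas'] welfare_update_entry[of M u x i t r ystar]
      by (simp add: r_def p_def a_def c_def)
    \<comment> \<open>The tangent is taken at the moved point: this bounds the gain from below,
      whereas the tangent at \<open>a\<close> would bound it from above.\<close>
    moreover have "integral {0..a} p - integral {0..a + h * d} p \<le> p (a + h * d) * (a - (a + h * d))"
      unfolding p_def a_def
      by (rule integral_antimono_le_tangent)
         (use valid_market_demand[OF M] aggregate_nonneg[OF feas] nonneg in \<open>auto simp: a_def\<close>)
    ultimately have "h * ((p (a + h * d) - c) * d) \<le> 0"
      by (simp add: algebra_simps)
    then show ?thesis using h by (simp add: mult_le_0_iff)
  qed
  have "isCont p z" for z
    using valid_market_demand(1)[OF M] by (simp add: p_def continuous_on_eq_continuous_at)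
  then have "isCont (\<lambda>h. p (a + h * d)) 0"
    by (intro isCont_o2[where f = "\<lambda>h. a + h * d" and g = p] continuous_intros)
  then have "isCont (\<lambda>h. (p (a + h * d) - c) * d) 0"
    by (intro continuous_intros)
  then have "((\<lambda>h. (p (a + h * d) - c) * d) \<longlongrightarrow> (p a - c) * d) (at_right 0)"
    by (auto simp: isCont_def intro: filterlim_mono at_le)
  moreover have "eventually (\<lambda>h. (p (a + h * d) - c) * d \<le> 0) (at_right (0::real))"
    using step by (auto simp: eventually_at_right_field intro!: exI[of _ 1])
  ultimately show ?thesis
    using tendsto_upperbound[OF _ _ trivial_limit_at_right_real]
    by (simp add: p_def a_def c_def d_def)
qed

section \<open>Producer profit in closed form\<close>

text \<open>The best operating profit per unit of capacity: run at capacity when the margin is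
  positive, idle when it is negative.\<close>

definition margin_sum ::
    "('n::finite, 't::finite) market \<Rightarrow> ('t \<Rightarrow> real ^ 't ^ 'n \<Rightarrow> real)
      \<Rightarrow> 'n \<Rightarrow> real ^ 't ^ 'n \<Rightarrow> real" where
  "margin_sum M \<pi> i u = (\<Sum>t\<in>UNIV. max 0 (\<pi> t u - unc_cost M u i t))"

text \<open>The inner problem splits over time into linear problems on \<open>[0, z]\<close>.
  Linearity in \<open>z\<close> is what later makes all capacities equally good.\<close>

lemma best_profit_eq:
  assumes "0 \<le> z"
  shows "best_profit M \<pi> \<eta> i z u = z * (margin_sum M \<pi> i u - (inv_cost M $ i - \<eta> $ i))"
  unfolding best_profit_def
proof (rule cSup_eq_maximum)
  let ?m = "\<lambda>t. \<pi> t u - unc_cost M u i t"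
  let ?xi = "\<chi> t. if 0 \<le> ?m t then z else 0"
  have eq: "z * (margin_sum M \<pi> i u - (inv_cost M $ i - \<eta> $ i))
      = (\<Sum>t\<in>UNIV. z * max 0 (?m t)) - (inv_cost M $ i - \<eta> $ i) * z"
    by (simp add: margin_sum_def sum_distrib_left algebra_simps)
  have val: "profit M \<pi> \<eta> i z u ?xi = z * (margin_sum M \<pi> i u - (inv_cost M $ i - \<eta> $ i))"
    unfolding profit_def eq by (intro arg_cong2[where f = "(-)"] sum.cong) auto
  have mem: "?xi \<in> production_set z"
    using assms by (auto simp: production_set_def)
  show "z * (margin_sum M \<pi> i u - (inv_cost M $ i - \<eta> $ i))
      \<in> profit M \<pi> \<eta> i z u ` production_set z"
    unfolding val[symmetric] using mem by (rule imageI)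
  fix v assume "v \<in> profit M \<pi> \<eta> i z u ` production_set z"
  then obtain xi where xi: "xi \<in> production_set z" and v: "v = profit M \<pi> \<eta> i z u xi"
    by auto
  have "?m t * xi $ t \<le> z * max 0 (?m t)" for t
  proof -
    have "?m t * xi $ t \<le> max 0 (?m t) * xi $ t"
      using xi by (intro mult_right_mono) (auto simp: production_set_def)
    also have "\<dots> \<le> max 0 (?m t) * z"
      using xi by (intro mult_left_mono) (auto simp: production_set_def)
    finally show ?thesis by (simp add: mult.commute)
  qed
  then show "v \<le> z * (margin_sum M \<pi> i u - (inv_cost M $ i - \<eta> $ i))"
    unfolding v profit_def eq by (intro diff_mono sum_mono) auto
qed

section \<open>KKT solutions and the largest subsidy of a scenario\<close>

lemma kkt_variational_inequality:
  assumes "kkt_system M ystar u x y \<mu> \<phi> \<kappa> \<eta>" and s: "0 \<le> s" "s \<le> ystar $ i"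
  shows "(demand M t (aggregate x t) - unc_cost M u i t) * (s - x $ i $ t) \<le> 0"
proof -
  have "demand M t (aggregate x t) - unc_cost M u i t - \<mu> $ i $ t + \<phi> $ i $ t = 0"
    and \<mu>: "\<mu> $ i $ t * (x $ i $ t - ystar $ i) = 0" "0 \<le> \<mu> $ i $ t"
    and \<phi>: "\<phi> $ i $ t * x $ i $ t = 0" "0 \<le> \<phi> $ i $ t"
    using assms(1) unfolding kkt_system_def by metis+
  then have eq: "demand M t (aggregate x t) - unc_cost M u i t = \<mu> $ i $ t - \<phi> $ i $ t"
    by linarith
  \<comment> \<open>Complementarity replaces \<open>x $ i $ t\<close> by \<open>ystar $ i\<close>
    next to \<mu> and by 0 next to \<phi>.\<close>
  have "(\<mu> $ i $ t - \<phi> $ i $ t) * (s - x $ i $ t)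
      = \<mu> $ i $ t * (s - ystar $ i) - \<phi> $ i $ t * s"
    using \<mu>(1) \<phi>(1) by algebra
  also have "\<dots> \<le> 0"
    using \<mu>(2) \<phi>(2) s by (smt (verit) mult_nonneg_nonneg mult_nonneg_nonpos)
  finally show ?thesis by (simp add: eq)
qed

text \<open>A monotonicity argument: each solution is tested against the other, the two inequalities
  are added so that the costs cancel, and the result is summed over producers. Strictly decreasing
  demand would make the final product positive if the aggregates differed.\<close>

lemma kkt_aggregate_unique:
  assumes M: "valid_market M" and opt: "fixed_capacity_optimal M ystar u x"
    and kkt: "kkt_system M ystar u x' y \<mu> \<phi> \<kappa> \<eta>"
  shows "aggregate x' t = aggregate x t"
proof -
  let ?p = "\<lambda>x. demand M t (aggregate x t)"
  have x: "0 \<le> x $ i $ t" "x $ i $ t \<le> ystar $ i" for i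
    using fixed_capacity_optimalD(1)[OF opt] by (auto simp: feasible_def)
  have x': "0 \<le> x' $ i $ t" "x' $ i $ t \<le> ystar $ i" for i
    using kkt unfolding kkt_system_def by metis+
  have "(?p x' - ?p x) * (x $ i $ t - x' $ i $ t) \<le> 0" for i
    using kkt_variational_inequality[OF kkt x, of t] fixed_capacity_first_order[OF M opt x', of t]
    by (smt (verit, best) left_diff_distrib right_diff_distrib)
  then have "(\<Sum>i\<in>UNIV. (?p x' - ?p x) * (x $ i $ t - x' $ i $ t)) \<le> 0"
    by (intro sum_nonpos)
  then have "(?p x' - ?p x) * (aggregate x t - aggregate x' t) \<le> 0"
    by (simp add: aggregate_def sum_distrib_left sum_subtractf right_diff_distrib)
  then show ?thesis
    using valid_market_demand(3)[OF M, of "aggregate x t" "aggregate x' t" t]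
      valid_market_demand(3)[OF M, of "aggregate x' t" "aggregate x t" t]
    by (smt (verit) mult_pos_pos mult_neg_neg)
qed

text \<open>Stationarity and the signs of \<mu> and \<phi> force \<mu> to be at least the positive
  part of the margin, at a price that does not depend on the KKT solution. A positive \<kappa> only
  lowers the subsidy.\<close>

lemma kkt_subsidy_le:
  assumes M: "valid_market M" and opt: "fixed_capacity_optimal M ystar u (x u)"
    and kkt: "kkt_system M ystar u x' y \<mu> \<phi> \<kappa> \<eta>"
  shows "\<eta> $ i \<le> inv_cost M $ i - margin_sum M (market_price M x) i u"
proof -
  have "max 0 (market_price M x t u - unc_cost M u i t) \<le> \<mu> $ i $ t" for t
  proof -
    have "demand M t (aggregate x' t) - unc_cost M u i t - \<mu> $ i $ t + \<phi> $ i $ t = 0"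
      "0 \<le> \<mu> $ i $ t" "0 \<le> \<phi> $ i $ t"
      using kkt by (auto simp: kkt_system_def)
    then show ?thesis
      by (simp add: market_price_def kkt_aggregate_unique[OF M opt kkt])
  qed
  then have "margin_sum M (market_price M x) i u \<le> (\<Sum>t\<in>UNIV. \<mu> $ i $ t)"
    unfolding margin_sum_def by (rule sum_mono)
  moreover have "- inv_cost M $ i + (\<Sum>t\<in>UNIV. \<mu> $ i $ t) + \<kappa> $ i + \<eta> $ i = 0" "0 \<le> \<kappa> $ i"
    using kkt by (auto simp: kkt_system_def)
  ultimately show ?thesis by linarith
qed

text \<open>The upper bound on the subsidy is attained by the smallest multipliers: \<mu> and \<phi>
  are the positive and negative parts of the margin, and \<kappa> is 0.\<close>

lemma margin_subsidy_in_kkt_subsidies: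
  assumes M: "valid_market M" and u: "u \<in> uset M"
    and opt: "fixed_capacity_optimal M ystar u (x u)"
  shows "inv_cost M $ i - margin_sum M (market_price M x) i u \<in> kkt_subsidies M ystar i"
proof -
  let ?m = "\<lambda>i t. market_price M x t u - unc_cost M u i t"
  define \<mu> where "\<mu> = (\<chi> i t. max 0 (?m i t))"
  define \<phi> where "\<phi> = (\<chi> i t. max 0 (- ?m i t))"
  define \<eta> where "\<eta> = (\<chi> i. inv_cost M $ i - margin_sum M (market_price M x) i u)"
  have feas: "0 \<le> x u $ i $ t" "x u $ i $ t \<le> ystar $ i" "0 \<le> ystar $ i" for i t
    using fixed_capacity_optimalD(1)[OF opt] by (auto simp: feasible_def)
  \<comment> \<open>The two ends of the box, \<open>s = ystar $ i\<close> and \<open>s = 0\<close>,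
    yield complementarity.\<close>
  have comp: "?m i t * (ystar $ i - x u $ i $ t) \<le> 0" "?m i t * x u $ i $ t \<ge> 0" for i t
    using fixed_capacity_first_order[OF M opt, of "ystar $ i" i t]
      fixed_capacity_first_order[OF M opt, of 0 i t] feas
    by (auto simp: market_price_def)
  have "\<mu> $ i $ t * (x u $ i $ t - ystar $ i) = 0" for i t
    using comp(1)[of t i] feas(2)[of i t] by (auto simp: \<mu>_def max_def mult_le_0_iff)
  moreover have "\<phi> $ i $ t * x u $ i $ t = 0" for i t
    using comp(2)[of t i] feas(1)[of i t] by (auto simp: \<phi>_def max_def zero_le_mult_iff)
  ultimately have "kkt_system M ystar u (x u) ystar \<mu> \<phi> 0 \<eta>"
    using feas unfolding kkt_system_def
    by (auto simp: \<mu>_def \<phi>_def \<eta>_def margin_sum_def market_price_def max_def)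
  then show ?thesis
    using u unfolding kkt_subsidies_def \<eta>_def by force
qed

section \<open>Optimality of investment, production and consumption\<close>

lemma investment_optimal_of_max_subsidy:
  assumes M: "valid_market M"
    and opt: "\<And>u. u \<in> uset M \<Longrightarrow> fixed_capacity_optimal M ystar u (x u)"
    and sub: "is_max_subsidy M ystar \<eta>" and yi: "0 \<le> yi"
  shows "investment_optimal M (market_price M x) \<eta> i yi"
proof -
  let ?\<pi> = "market_price M x"
  let ?g = "\<lambda>u. margin_sum M ?\<pi> i u - (inv_cost M $ i - \<eta> $ i)"
  have g_nonneg: "0 \<le> ?g u" if u: "u \<in> uset M" for u
    using sub margin_subsidy_in_kkt_subsidies[OF M u, of ystar x i] opt[OF u]
    by (force simp: is_max_subsidy_def)
  have "\<eta> $ i \<in> kkt_subsidies M ystar i"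
    using sub by (simp add: is_max_subsidy_def)
  then obtain x' y \<mu> \<phi> \<kappa> \<eta>' u0 where u0: "u0 \<in> uset M" and \<eta>': "\<eta> $ i = \<eta>' $ i"
    and kkt: "kkt_system M ystar u0 x' y \<mu> \<phi> \<kappa> \<eta>'"
    unfolding kkt_subsidies_def by blast
  have "\<eta> $ i \<le> inv_cost M $ i - margin_sum M ?\<pi> i u0"
    unfolding \<eta>' using M opt[OF u0] kkt by (rule kkt_subsidy_le)
  \<comment> \<open>In the scenario where the maximal subsidy arises, its upper bound is tight.
    Hence \<open>u0\<close> is a worst case for every capacity at once, with profit 0.\<close>
  with g_nonneg[OF u0] have g0: "?g u0 = 0" by linarith
  have attained: "is_arg_min (best_profit M ?\<pi> \<eta> i z) (\<lambda>u. u \<in> uset M) u0" if z: "0 \<le> z" for z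
    using u0 g0 g_nonneg z by (auto simp: is_arg_min_def best_profit_eq not_less)
  have zero: "worst_case_profit M ?\<pi> \<eta> i z = 0" if z: "0 \<le> z" for z
    unfolding worst_case_profit_def
  proof (rule cInf_eq_minimum)
    show "0 \<in> best_profit M ?\<pi> \<eta> i z ` uset M"
      using u0 g0 z by (force simp: best_profit_eq)
    show "0 \<le> v" if "v \<in> best_profit M ?\<pi> \<eta> i z ` uset M" for v
      using that g_nonneg z by (auto simp: best_profit_eq)
  qed
  show ?thesis
    unfolding investment_optimal_def using attained zero yi by (auto simp: is_arg_max_def)
qed

text \<open>The planner's first-order condition, with \<open>s\<close> the rival production in
  period \<open>t\<close>, compares the profits period by period; the investment term is common to
  both.\<close>

lemma production_optimal_market_price:
  fixes M :: "('n::finite, 't::finite) market"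
  assumes M: "valid_market M" and opt: "fixed_capacity_optimal M ystar u (x u)"
  shows "production_optimal M (market_price M x) \<eta> i (ystar $ i) u (x u $ i)"
  unfolding production_optimal_def is_arg_max_linorder
proof (intro conjI allI impI)
  show "x u $ i \<in> production_set (ystar $ i)"
    using fixed_capacity_optimalD(1)[OF opt] by (auto simp: feasible_def production_set_def)
  fix xi :: "real ^ 't" assume xi: "xi \<in> production_set (ystar $ i)"
  show "profit M (market_price M x) \<eta> i (ystar $ i) u xi
      \<le> profit M (market_price M x) \<eta> i (ystar $ i) u (x u $ i)"
    unfolding profit_def
  proof (intro diff_right_mono sum_mono)
    fix t
    show "(market_price M x t u - unc_cost M u i t) * xi $ t
        \<le> (market_price M x t u - unc_cost M u i t) * x u $ i $ t"
      using fixed_capacity_first_order[OF M opt, of "xi $ t" i t] xi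
      by (simp add: production_set_def market_price_def right_diff_distrib)
  qed
qed

text \<open>The price is the slope of the concave consumer integral at the traded quantity, so the
  tangent bound is exactly optimality.\<close>

lemma consumer_optimal_market_price:
  assumes M: "valid_market M" and nonneg: "0 \<le> aggregate (x u) t"
  shows "consumer_optimal M (market_price M x) u t (aggregate (x u) t)"
  unfolding consumer_optimal_def is_arg_max_linorder
  using nonneg integral_antimono_le_tangent[OF valid_market_demand(1,2)[OF M] nonneg, of _ t]
  by (auto simp: market_price_def algebra_simps)

theorem theorem5p5:
  fixes M :: "('n::finite, 't::finite) market"
    and xhat :: "real ^ 't ^ 'n"
    and ystar \<eta>star :: "real ^ 'n"
    and xstar :: "real ^ 't ^ 'n \<Rightarrow> real ^ 't ^ 'n"
  assumes "valid_market M"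
    and "robust_planner_optimal M xhat ystar"
    and "\<And>u. u \<in> uset M \<Longrightarrow> fixed_capacity_optimal M ystar u (xstar u)"
    and "is_max_subsidy M ystar \<eta>star"
  shows "is_equilibrium M (market_price M xstar) \<eta>star ystar xstar"
proof -
  have y: "0 \<le> ystar $ i" for i
    using assms(2) by (auto simp: robust_planner_optimal_def is_arg_max_def feasible_def)
  have feas: "feasible (xstar u, ystar)" if "u \<in> uset M" for u
    by (rule fixed_capacity_optimalD(1)[OF assms(3)[OF that]])
  show ?thesis
    unfolding is_equilibrium_def
  proof (intro conjI ballI allI)
    show "0 \<le> xstar u $ i $ t" if "u \<in> uset M" for u i t
      using feas[OF that] by (auto simp: feasible_def)
    show "investment_optimal M (market_price M xstar) \<eta>star i (ystar $ i)" for i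
      using assms(1,3,4) y by (rule investment_optimal_of_max_subsidy)
    show "production_optimal M (market_price M xstar) \<eta>star i (ystar $ i) u (xstar u $ i)"
      if "u \<in> uset M" for u i
      using assms(1) assms(3)[OF that] by (rule production_optimal_market_price)
    show "consumer_optimal M (market_price M xstar) u t (aggregate (xstar u) t)"
      if "u \<in> uset M" for u t
      using assms(1) aggregate_nonneg[OF feas[OF that]] by (rule consumer_optimal_market_price)
  qed
qed

end
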